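(* Let $\mathbf{V}$ be a finite non-empty set of servers and let $\mathcal{S}$ be a federated Byzantine quorum system over $\mathbf{V}$ with quorum intersection. Let $\mathcal{Q}$ be the quorum system it induces (the set of all quorums in $\mathcal{S}$), and let $\mathcal{B}$ consist of the (inclusion-)maximal sets $B\subseteq\mathbf{V}$ such that the failure of $B$ leaves the set of intact servers in $\mathcal{S}$ non-empty (i.e. the set of intact servers in $\mathcal{S}$ computed with the set of faulty servers equal to $B$ is non-empty). Then $(\mathcal{Q},\mathcal{B})$ is a dissemination quorum system.
   Context: Federated Byzantine quorum system (FBQS) over $\mathbf{V}$: a function $\mathcal{S}$ assigning to each $v\in\mathbf{V}$ a non-empty set $\mathcal{S}(v)\subseteq 2^{\mathbf{V}}$ of quorum slices, with $v\in q$ for all $q\in\mathcal{S}(v)$. A non-empty $U\subseteq\mathbf{V}$ is a quorum in $\mathcal{S}$ if $\forall v\in U.\ \exists q\in\mathcal{S}(v).\ q\subseteq U$. $\mathcal{S}$ has (enjoys) quorum intersection if any two of its quorums intersect. Projection: for $I\subseteq\mathbf{V}$, $\mathcal{S}|_I$ is the FBQS over universe $I$ with $\mathcal{S}|_I(v)=\{q\cap I\mid q\in\mathcal{S}(v)\}$ for $v\in I$. Intact servers: given a set of faulty servers $\mathbf{V}_{\mathrm{bad}}\subseteq\mathbf{V}$, the set $\mathbf{V}_{\mathrm{int}}$ of intact servers in $\mathcal{S}$ is the biggest set such that $\mathbf{V}_{\mathrm{int}}\cap\mathbf{V}_{\mathrm{bad}}=\emptyset$; if $\mathbf{V}_{\mathrm{int}}$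 is non-empty then it is a quorum in $\mathcal{S}$; and $\mathcal{S}|_{\mathbf{V}_{\mathrm{int}}}$ enjoys quorum intersection. (For FBQSes with quorum intersection this biggest set exists and is unique.) A quorum system is a non-empty set $\mathcal{Q}\subseteq 2^{\mathbf{V}}$ such that every $U\in\mathcal{Q}$ is non-empty, any two $U_1,U_2\in\mathcal{Q}$ intersect, and $\mathcal{Q}$ is closed under binary union. A fail-prone system is a non-empty set $\mathcal{B}\subseteq 2^{\mathbf{V}}$ none of whose elements is contained in another. A dissemination quorum system is a pair $(\mathcal{Q},\mathcal{B})$ of a quorum system and a fail-prone system satisfying D-consistency: $\forall U_1,U_2\in\mathcal{Q}.\ \forall B\in\mathcal{B}.\ U_1\cap U_2\not\subseteq B$; and D-availability: $\forall B\in\mathcal{B}.\ \exists U\in\mathcal{Q}.\ U\cap B=\emptyset$. *)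

theory Defs
  imports Main
begin

text \<open>
  The universe is an explicit carrier set \<open>V\<close>, because projecting a system changes its universe.
  Only the values of \<open>S\<close> on the universe matter.
\<close>

definition fbqs :: "'a set \<Rightarrow> ('a \<Rightarrow> 'a set set) \<Rightarrow> bool" where
  "fbqs V S \<longleftrightarrow> (\<forall>v\<in>V. S v \<noteq> {} \<and> S v \<subseteq> Pow V \<and> (\<forall>q\<in>S v. v \<in> q))"

definition is_quorum :: "'a set \<Rightarrow> ('a \<Rightarrow> 'a set set) \<Rightarrow> 'a set \<Rightarrow> bool" where
  "is_quorum V S U \<longleftrightarrow> U \<noteq> {} \<and> U \<subseteq> V \<and> (\<forall>v\<in>U. \<exists>q\<in>S v. q \<subseteq> U)"

definition quorums :: "'a set \<Rightarrow> ('a \<Rightarrow> 'a set set) \<Rightarrow> 'a set set" where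
  "quorums V S = {U. is_quorum V S U}"

definition quorum_intersection :: "'a set \<Rightarrow> ('a \<Rightarrow> 'a set set) \<Rightarrow> bool" where
  "quorum_intersection V S \<longleftrightarrow> (\<forall>U1\<in>quorums V S. \<forall>U2\<in>quorums V S. U1 \<inter> U2 \<noteq> {})"

text \<open>The slices of the projection to \<open>I\<close>; its universe is \<open>I\<close>.\<close>

definition proj :: "('a \<Rightarrow> 'a set set) \<Rightarrow> 'a set \<Rightarrow> 'a \<Rightarrow> 'a set set" where
  "proj S I v = {q \<inter> I | q. q \<in> S v}"

definition intact_candidate ::
  "'a set \<Rightarrow> ('a \<Rightarrow> 'a set set) \<Rightarrow> 'a set \<Rightarrow> 'a set \<Rightarrow> bool" where
  "intact_candidate V S Bad I \<longleftrightarrow>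
     I \<subseteq> V \<and> I \<inter> Bad = {} \<and> (I \<noteq> {} \<longrightarrow> is_quorum V S I) \<and> quorum_intersection I (proj S I)"

text \<open>
  The order is set inclusion. The greatest candidate exists whenever \<open>S\<close> has quorum intersection;
  without that hypothesis the value may be unspecified.
\<close>

definition intact :: "'a set \<Rightarrow> ('a \<Rightarrow> 'a set set) \<Rightarrow> 'a set \<Rightarrow> 'a set" where
  "intact V S Bad = (GREATEST I. intact_candidate V S Bad I)"

definition quorum_system :: "'a set \<Rightarrow> 'a set set \<Rightarrow> bool" where
  "quorum_system V Q \<longleftrightarrow>
     Q \<noteq> {} \<and> Q \<subseteq> Pow V \<and> (\<forall>U\<in>Q. U \<noteq> {}) \<and>
     (\<forall>U1\<in>Q. \<forall>U2\<in>Q. U1 \<inter> U2 \<noteq> {}) \<and> (\<forall>U1\<in>Q. \<forall>U2\<in>Q. U1 \<union> U2 \<in> Q)"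

definition fail_prone_system :: "'a set \<Rightarrow> 'a set set \<Rightarrow> bool" where
  "fail_prone_system V \<B> \<longleftrightarrow>
     \<B> \<noteq> {} \<and> \<B> \<subseteq> Pow V \<and> (\<forall>B1\<in>\<B>. \<forall>B2\<in>\<B>. B1 \<noteq> B2 \<longrightarrow> \<not> B1 \<subseteq> B2)"

definition d_consistency :: "'a set set \<Rightarrow> 'a set set \<Rightarrow> bool" where
  "d_consistency Q \<B> \<longleftrightarrow> (\<forall>U1\<in>Q. \<forall>U2\<in>Q. \<forall>B\<in>\<B>. \<not> U1 \<inter> U2 \<subseteq> B)"

definition d_availability :: "'a set set \<Rightarrow> 'a set set \<Rightarrow> bool" where
  "d_availability Q \<B> \<longleftrightarrow> (\<forall>B\<in>\<B>. \<exists>U\<in>Q. U \<inter> B = {})"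

definition dissemination_quorum_system :: "'a set \<Rightarrow> 'a set set \<Rightarrow> 'a set set \<Rightarrow> bool" where
  "dissemination_quorum_system V Q \<B> \<longleftrightarrow>
     quorum_system V Q \<and> fail_prone_system V \<B> \<and> d_consistency Q \<B> \<and> d_availability Q \<B>"

definition tolerated_failures :: "'a set \<Rightarrow> ('a \<Rightarrow> 'a set set) \<Rightarrow> 'a set set" where
  "tolerated_failures V S = {B. B \<subseteq> V \<and> intact V S B \<noteq> {}}"

definition maximal_tolerated_failures :: "'a set \<Rightarrow> ('a \<Rightarrow> 'a set set) \<Rightarrow> 'a set set" where
  "maximal_tolerated_failures V S =
     {B \<in> tolerated_failures V S. \<forall>C\<in>tolerated_failures V S. \<not> B \<subset> C}"

end

(* A quorum of S, or of a projection of S to a superset of I, restricts to a quorum of S|I as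
   soon as it meets I. Hence the intact candidates are closed under union, so the set of intact
   servers is itself a candidate. If the set I of intact servers for B is non-empty, any two
   quorums of S meet I because I is a quorum; their traces on I are quorums of S|I and therefore
   meet each other inside I, which is disjoint from B. Availability is witnessed by I, and the
   empty set is tolerated because V is a candidate for it. *)

theory Submission
  imports Defs
begin

lemma proj_eq_image: "proj S I v = (\<lambda>q. q \<inter> I) ` S v"
  unfolding proj_def by (simp add: Setcompr_eq_image)

text \<open>A slice \<open>q\<close> inside \<open>U\<close> leaves the trace
  \<open>q \<inter> I\<close> inside \<open>U \<inter> I\<close>. \<open>I\<close> need not be a
  quorum, so the lemma applies to \<open>S\<close> and to any projection of it.\<close>

lemma is_quorum_proj_Int:
  assumes "is_quorum V S U" "U \<inter> I \<noteq> {}"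
  shows "is_quorum I (proj S I) (U \<inter> I)"
proof -
  have "\<exists>q\<in>proj S I v. q \<subseteq> U \<inter> I" if v: "v \<in> U \<inter> I" for v
  proof -
    from assms(1) v have "\<exists>q\<in>S v. q \<subseteq> U" unfolding is_quorum_def by simp
    then obtain q where "q \<in> S v" "q \<subseteq> U" ..
    then have "q \<inter> I \<in> proj S I v" unfolding proj_eq_image by (intro imageI)
    moreover have "q \<inter> I \<subseteq> U \<inter> I" using \<open>q \<subseteq> U\<close> by blast
    ultimately show ?thesis by (rule bexI[rotated])
  qed
  with assms(2) show ?thesis unfolding is_quorum_def by blast
qed

text \<open>Lets the trace lemma be applied with \<open>proj S J\<close> in place of
  \<open>S\<close>, so that quorums of a larger projection can be cut down to
  \<open>I\<close>.\<close>

lemma proj_proj: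
  assumes "I \<subseteq> J"
  shows "proj (proj S J) I = proj S I"
proof
  have "q \<inter> J \<inter> I = q \<inter> I" for q :: "'a set"
    using assms by blast
  then show "proj (proj S J) I v = proj S I v" for v
    unfolding proj_eq_image by (simp add: image_image)
qed

lemma is_quorum_proj_proj_Int:
  assumes "is_quorum J (proj S J) U" and "I \<subseteq> J" "U \<inter> I \<noteq> {}"
  shows "is_quorum I (proj S I) (U \<inter> I)"
  using is_quorum_proj_Int[OF assms(1,3)] by (simp only: proj_proj[OF assms(2)])

lemma is_quorum_Un:
  assumes "is_quorum V S U1" "is_quorum V S U2"
  shows "is_quorum V S (U1 \<union> U2)"
proof -
  have "\<exists>q\<in>S v. q \<subseteq> U1 \<union> U2" if "v \<in> U1 \<union> U2" for v
    using assms that unfolding is_quorum_def by (meson UnE le_supI1 le_supI2)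
  with assms show ?thesis unfolding is_quorum_def by simp
qed

lemma quorum_intersectionD:
  assumes "quorum_intersection V S" "is_quorum V S U1" "is_quorum V S U2"
  shows "U1 \<inter> U2 \<noteq> {}"
  using assms unfolding quorum_intersection_def quorums_def by simp

lemma is_quorum_universe:
  assumes "V \<noteq> {}" "fbqs V S"
  shows "is_quorum V S V"
proof -
  have "\<exists>q\<in>S v. q \<subseteq> V" if "v \<in> V" for v
  proof -
    have "S v \<noteq> {}" "S v \<subseteq> Pow V"
      using assms(2) that unfolding fbqs_def by auto
    then show ?thesis by blast
  qed
  with assms(1) show ?thesis unfolding is_quorum_def by simp
qed

text \<open>Slices of points of \<open>V\<close> lie in \<open>V\<close>, so cutting them with
  \<open>V\<close> changes nothing there. Outside \<open>V\<close> the two slice functions may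
  differ, so quorums are compared rather than functions.\<close>

lemma is_quorum_proj_universe:
  assumes "fbqs V S"
  shows "is_quorum V (proj S V) U \<longleftrightarrow> is_quorum V S U"
proof -
  have "proj S V v = S v" if "v \<in> V" for v
  proof -
    have "q \<inter> V = q" if "q \<in> S v" for q
      using assms \<open>v \<in> V\<close> that unfolding fbqs_def by blast
    then show ?thesis unfolding proj_eq_image by simp
  qed
  then have "(\<exists>q\<in>proj S V v. q \<subseteq> U) \<longleftrightarrow> (\<exists>q\<in>S v. q \<subseteq> U)" if "v \<in> V" for v
    using that by simp
  then show ?thesis unfolding is_quorum_def by (meson subsetD)
qed

lemma intact_candidate_empty: "intact_candidate V S B {}"
  unfolding intact_candidate_def quorum_intersection_def quorums_def is_quorum_def by simp

text \<open>The difficulty is intersection in the projection to the union, where one quorum might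
  live near \<open>I1\<close> and another near \<open>I2\<close>. Quorum intersection of
  \<open>S\<close> links the two parts: every quorum of that projection is forced to meet
  \<open>I1\<close>, where intersection is already known.\<close>

lemma intact_candidate_Un:
  assumes qi: "quorum_intersection V S"
    and 1: "intact_candidate V S B I1" and 2: "intact_candidate V S B I2"
  shows "intact_candidate V S B (I1 \<union> I2)"
proof (cases "I1 = {} \<or> I2 = {}")
  case True
  with 1 2 show ?thesis by auto
next
  case False
  have q1: "is_quorum V S I1" and q2: "is_quorum V S I2"
    and qi1: "quorum_intersection I1 (proj S I1)" and qi2: "quorum_intersection I2 (proj S I2)"
    using 1 2 False unfolding intact_candidate_def by auto
  let ?J = "I1 \<union> I2"
  have meets: "U \<inter> I1 \<noteq> {}" if U: "is_quorum ?J (proj S ?J) U" for U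
  proof
    assume disj: "U \<inter> I1 = {}"
    with U have "U \<inter> I2 \<noteq> {}" unfolding is_quorum_def by blast
    with U have "is_quorum I2 (proj S I2) (U \<inter> I2)"
      by (intro is_quorum_proj_proj_Int) auto
    \<comment> \<open>\<open>I1\<close> leaves a trace on \<open>I2\<close>, non-empty because both
      are quorums of \<open>S\<close>. As a quorum of the projection to \<open>I2\<close>, this
      trace must meet that of \<open>U\<close>, which puts a point of \<open>U\<close> in
      \<open>I1\<close>.\<close>
    moreover have "is_quorum I2 (proj S I2) (I1 \<inter> I2)"
      using q1 q2 qi by (intro is_quorum_proj_Int quorum_intersectionD)
    ultimately have "(U \<inter> I2) \<inter> (I1 \<inter> I2) \<noteq> {}" by (rule quorum_intersectionD[OF qi2])
    with disj show False by blast
  qed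
  have "U1 \<inter> U2 \<noteq> {}"
    if "is_quorum ?J (proj S ?J) U1" "is_quorum ?J (proj S ?J) U2" for U1 U2
  proof -
    have "(U1 \<inter> I1) \<inter> (U2 \<inter> I1) \<noteq> {}"
      by (rule quorum_intersectionD[OF qi1];
          rule is_quorum_proj_proj_Int[of ?J]; intro that meets Un_upper1)
    then show ?thesis by blast
  qed
  then have "quorum_intersection ?J (proj S ?J)"
    unfolding quorum_intersection_def quorums_def by blast
  with 1 2 is_quorum_Un[OF q1 q2] show ?thesis unfolding intact_candidate_def by blast
qed

text \<open>Finiteness gives a maximal candidate, and closure under union makes it the greatest, so
  \<open>GREATEST\<close> denotes it.\<close>

lemma
  assumes fin: "finite V" and qi: "quorum_intersection V S"
  shows intact_candidate_intact: "intact_candidate V S B (intact V S B)"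
    and intact_candidate_subset_intact: "intact_candidate V S B I \<Longrightarrow> I \<subseteq> intact V S B"
proof -
  have "finite {I. intact_candidate V S B I}"
    by (rule finite_subset[of _ "Pow V"]) (use fin in \<open>auto simp: intact_candidate_def\<close>)
  then obtain M where M: "intact_candidate V S B M"
    and max: "\<And>I. intact_candidate V S B I \<Longrightarrow> M \<subseteq> I \<Longrightarrow> M = I"
    using finite_has_maximal2[of "{I. intact_candidate V S B I}" "{}"]
    by (auto simp: intact_candidate_empty)
  \<comment> \<open>The union of \<open>M\<close> and \<open>I\<close> is a candidate above the
    maximal \<open>M\<close>, hence equal to \<open>M\<close>.\<close>
  have greatest: "I \<subseteq> M" if "intact_candidate V S B I" for I
    using max[OF intact_candidate_Un[OF qi M that] Un_upper1] by (metis Un_upper2)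
  have "intact V S B = M"
    unfolding intact_def using M greatest by (rule Greatest_equality)
  with M greatest show "intact_candidate V S B (intact V S B)"
    and "intact_candidate V S B I \<Longrightarrow> I \<subseteq> intact V S B"
    by auto
qed

lemma quorum_system_quorums:
  assumes "V \<noteq> {}" "fbqs V S" "quorum_intersection V S"
  shows "quorum_system V (quorums V S)"
  unfolding quorum_system_def
proof (intro conjI)
  show "quorums V S \<noteq> {}"
    using is_quorum_universe[OF assms(1,2)] unfolding quorums_def by blast
  show "quorums V S \<subseteq> Pow V" "\<forall>U\<in>quorums V S. U \<noteq> {}"
    unfolding quorums_def is_quorum_def by auto
  show "\<forall>U1\<in>quorums V S. \<forall>U2\<in>quorums V S. U1 \<inter> U2 \<noteq> {}"
    using assms(3) unfolding quorum_intersection_def .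
  show "\<forall>U1\<in>quorums V S. \<forall>U2\<in>quorums V S. U1 \<union> U2 \<in> quorums V S"
    unfolding quorums_def by (auto intro: is_quorum_Un)
qed

lemma empty_in_tolerated_failures:
  assumes "finite V" "V \<noteq> {}" "fbqs V S" "quorum_intersection V S"
  shows "{} \<in> tolerated_failures V S"
proof -
  have "quorum_intersection V (proj S V)"
    using assms(4) unfolding quorum_intersection_def quorums_def
    by (simp add: is_quorum_proj_universe[OF assms(3)])
  then have "intact_candidate V S {} V"
    using is_quorum_universe[OF assms(2,3)] unfolding intact_candidate_def by simp
  with intact_candidate_subset_intact[OF assms(1,4)] assms(2) show ?thesis
    unfolding tolerated_failures_def by blast
qed

text \<open>A non-empty finite family has a maximal member, and distinct maximal members are
  incomparable.\<close>

lemma fail_prone_system_maximal_tolerated_failures: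
  assumes "finite V" "tolerated_failures V S \<noteq> {}"
  shows "fail_prone_system V (maximal_tolerated_failures V S)"
proof -
  have "finite (tolerated_failures V S)"
    by (rule finite_subset[of _ "Pow V"]) (use assms(1) in \<open>auto simp: tolerated_failures_def\<close>)
  from finite_has_maximal[OF this assms(2)] have "maximal_tolerated_failures V S \<noteq> {}"
    unfolding maximal_tolerated_failures_def by (auto simp: psubset_eq)
  then show ?thesis
    unfolding fail_prone_system_def maximal_tolerated_failures_def tolerated_failures_def by blast
qed

theorem theorem10:
  fixes V :: "'a set" and S :: "'a \<Rightarrow> 'a set set"
  assumes "finite V" and "V \<noteq> {}"
    and "fbqs V S"
    and "quorum_intersection V S"
  shows "dissemination_quorum_system V (quorums V S) (maximal_tolerated_failures V S)"
proof -
  \<comment> \<open>Membership of \<open>B\<close> makes the intact set non-empty, which discharges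
    the premise under which a candidate is a quorum.\<close>
  have intact: "is_quorum V S (intact V S B)" "intact V S B \<inter> B = {}"
    "quorum_intersection (intact V S B) (proj S (intact V S B))"
    if "B \<in> maximal_tolerated_failures V S" for B
    using intact_candidate_intact[OF assms(1,4), of B] that
    unfolding intact_candidate_def maximal_tolerated_failures_def tolerated_failures_def by auto
  have "\<not> U1 \<inter> U2 \<subseteq> B"
    if "is_quorum V S U1" "is_quorum V S U2" and B: "B \<in> maximal_tolerated_failures V S"
    for U1 U2 B
  proof -
    let ?I = "intact V S B"
    \<comment> \<open>Quorum intersection of \<open>S\<close> alone could yield a common point in
      \<open>B\<close>; here the common point is found inside \<open>?I\<close>.\<close>
    have "(U1 \<inter> ?I) \<inter> (U2 \<inter> ?I) \<noteq> {}"
      by (rule quorum_intersectionD[OF intact(3)[OF B]]; rule is_quorum_proj_Int[of V];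
          intro quorum_intersectionD[OF assms(4)] that intact(1)[OF B])
    with intact(2)[OF B] show ?thesis by blast
  qed
  then have "d_consistency (quorums V S) (maximal_tolerated_failures V S)"
    unfolding d_consistency_def quorums_def by blast
  moreover have "d_availability (quorums V S) (maximal_tolerated_failures V S)"
    using intact(1,2) unfolding d_availability_def quorums_def by blast
  moreover have "fail_prone_system V (maximal_tolerated_failures V S)"
    using fail_prone_system_maximal_tolerated_failures[OF assms(1)]
      empty_in_tolerated_failures[OF assms] by blast
  ultimately show ?thesis
    using quorum_system_quorums[OF assms(2-4)] unfolding dissemination_quorum_system_def by simp
qed

end
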